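(* For every fixed integer $t\ge 2$ and all sufficiently large $n$, $z(n^{2/t}, n; t, 2)=\Theta(n^{1+1/t})$; that is, there are constants $c_t,C_t>0$ such that for all large enough $n$, the maximum number of 1s in an $\lfloor n^{2/t}\rfloor\times n$ 0-1 matrix containing no all-1 $t\times 2$ submatrix lies between $c_t n^{1+1/t}$ and $C_t n^{1+1/t}$.
   Context: For positive integers $m,n,s,t$, $z(m,n;s,t)$ denotes the maximum number of 1s in an $m\times n$ matrix with entries in $\{0,1\}$ that contains no $s\times t$ all-1 submatrix, i.e., there are no $s$ rows and $t$ columns (not necessarily consecutive) all of whose $st$ intersecting entries equal 1. *)

theory Defs
  imports
    "HOL-Library.Landau_Symbols"
    "Jordan_Normal_Form.Matrix"
begin

definition zero_one_mat :: "nat \<Rightarrow> nat \<Rightarrow> nat mat set" where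
  "zero_one_mat m n = {A \<in> carrier_mat m n. elements_mat A \<subseteq> {0, 1}}"

definition ones :: "nat mat \<Rightarrow> nat" where
  "ones A = card {(i, j). i < dim_row A \<and> j < dim_col A \<and> A $$ (i, j) = 1}"

definition has_all_ones_submatrix :: "nat \<Rightarrow> nat \<Rightarrow> nat mat \<Rightarrow> bool" where
  "has_all_ones_submatrix s t A \<longleftrightarrow>
     (\<exists>I J. I \<subseteq> {..<dim_row A} \<and> J \<subseteq> {..<dim_col A} \<and> card I = s \<and> card J = t \<and>
            (\<forall>i\<in>I. \<forall>j\<in>J. A $$ (i, j) = 1))"

(* Meaningful for positive s and t only: if s or t is 0, an empty submatrix can be
   all-one vacuously, and the set below may be empty. *)
definition zarankiewicz :: "nat \<Rightarrow> nat \<Rightarrow> nat \<Rightarrow> nat \<Rightarrow> nat" where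
  "zarankiewicz m n s t =
     Max (ones ` {A \<in> zero_one_mat m n. \<not> has_all_ones_submatrix s t A})"

lemma ones_le: "A \<in> zero_one_mat m n \<Longrightarrow> ones A \<le> card ({..<m} \<times> {..<n})"
  unfolding ones_def zero_one_mat_def by (rule card_mono) auto

lemma finite_ones_image: "finite (ones ` {A \<in> zero_one_mat m n. P A})"
  by (rule finite_subset[of _ "{..card ({..<m} \<times> {..<n})}"])
     (use ones_le in blast, simp)

lemma zarankiewicz_feasible_nonempty:
  assumes "s > 0" and "t > 0"
  shows "0\<^sub>m m n \<in> {A \<in> zero_one_mat m n. \<not> has_all_ones_submatrix s t A}"
proof -
  have "\<not> has_all_ones_submatrix s t (0\<^sub>m m n)"
  proof
    assume "has_all_ones_submatrix s t (0\<^sub>m m n)"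
    then obtain I J where *: "I \<subseteq> {..<m}" "J \<subseteq> {..<n}" "card I = s" "card J = t"
      "\<forall>i\<in>I. \<forall>j\<in>J. (0\<^sub>m m n :: nat mat) $$ (i, j) = 1"
      unfolding has_all_ones_submatrix_def by auto
    with assms obtain i j where "i \<in> I" "j \<in> J" by fastforce
    with * have "i < m" "j < n" "(0\<^sub>m m n :: nat mat) $$ (i, j) = 1" by auto
    then show False by simp
  qed
  then show ?thesis
    by (auto simp: zero_one_mat_def elements_mat_def)
qed

end

theory Submission
  imports Defs "HOL-Algebra.Algebraic_Closure_Type" "HOL-Library.Z2"
begin

text \<open>
  Upper bound: every set of \<open>t\<close> rows lies in at most one column, so
  \<open>\<Sum>\<^sub>j (d\<^sub>j choose t) \<le> (m choose t)\<close> for the column sums \<open>d\<^sub>j\<close>. With \<open>a = n\<^bsup>1/t\<^esup>\<close>, a column sum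
  exceeding \<open>t a\<close> is at most \<open>t (d\<^sub>j choose t) / a\<^bsup>t-1\<^esup>\<close>.

  Lower bound: for a field \<open>F\<close> of order \<open>q\<close>, the rows are the points of \<open>F\<^sup>2\<close> and the columns are
  the graphs of the \<open>q\<^bsup>t\<^esup>\<close> polynomials of degree less than \<open>t\<close>; two such graphs meet in fewer than
  \<open>t\<close> points. Choosing \<open>q\<close> as a power of 2 loses only a constant factor and avoids any result on
  the distribution of primes; the fields are found inside the algebraic closure of the field with
  two elements, as the roots of \<open>X\<^bsup>q\<^esup> - X\<close>.
\<close>

section \<open>Finite subfields of an algebraically closed field\<close>

text \<open>Over an algebraically closed field \<open>p\<close> splits into linear factors, and a
  repeated factor would give a common root of \<open>p\<close> and its derivative. So the multiset
  of roots is a set.\<close>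

lemma card_roots_eq_degree:
  fixes p :: "'a :: alg_closed_field poly"
  assumes "p \<noteq> 0" and simple: "\<And>x. poly p x = 0 \<Longrightarrow> poly (pderiv p) x \<noteq> 0"
  shows "card {x. poly p x = 0} = Polynomial.degree p"
proof -
  obtain A where A: "size A = Polynomial.degree p"
      "p = smult (lead_coeff p) (\<Prod>x\<in>#A. [:-x, 1:])"
    using alg_closed_imp_factorization[OF assms(1)] by blast
  have "count A x \<le> 1" for x
  proof (rule ccontr)
    assume "\<not> count A x \<le> 1"
    then have "{#x, x#} \<subseteq># A"
      by (auto simp: subseteq_mset_def)
    then obtain B where "A = {#x, x#} + B"
      by (metis subset_mset.add_diff_inverse)
    then obtain r where r: "p = [:-x, 1:] * ([:-x, 1:] * r)"
      using A(2) by (metis (no_types, lifting) image_mset_add_mset image_mset_union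
          mult_smult_right prod_mset.add_mset add_mset_add_single union_mset_add_mset_left
          empty_neutral(1))
    have "poly p x = 0" "poly (pderiv p) x = 0"
      by (simp_all only: r pderiv_mult poly_mult poly_add) simp_all
    with simple show False by blast
  qed
  \<comment> \<open>Multiplicities at most 1 turn the size of the multiset \<open>A\<close> into a
    count of distinct roots.\<close>
  then have "A = mset_set (set_mset A)"
    by (intro multiset_eqI) (metis count_eq_zero_iff count_mset_set(1,3) finite_set_mset
        le_SucE le_zero_eq One_nat_def)
  then have "size A = card (set_mset A)"
    by (metis size_mset_set)
  moreover have "poly (\<Prod>x\<in>#A. [:-x, 1:]) y = 0 \<longleftrightarrow> y \<in># A" for y
    by (induction A) auto
  then have "{x. poly p x = 0} = set_mset A"
    using assms(1) by (subst A(2)) auto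
  ultimately show ?thesis
    using A(1) by simp
qed

text \<open>The fixed points are the roots of X^q - X, which is separable: since q vanishes in the
  field, its derivative is the constant -1.\<close>

lemma card_frobenius_fixed_points:
  fixes q :: nat
  assumes p: "Factorial_Ring.prime CHAR('a :: alg_closed_field)" and "k > 0" and q: "q = CHAR('a) ^ k"
  shows "card {x :: 'a. x ^ q = x} = q"
proof -
  have "q > 1"
    using assms by (metis one_less_power prime_gt_1_nat)
  let ?P = "Polynomial.monom 1 q - Polynomial.monom (1 :: 'a) 1"
  have "of_nat q = (0 :: 'a)"
    using \<open>k > 0\<close> by (simp add: q)
  then have d: "pderiv ?P = - 1"
    by (simp add: pderiv_diff pderiv_monom one_pCons monom_0)
  have "Polynomial.degree ?P = q"
    using \<open>q > 1\<close> by (subst diff_conv_add_uminus, subst degree_add_eq_left)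
      (simp_all add: degree_monom_eq)
  moreover have "?P \<noteq> 0"
    using d by (metis pderiv_0 neg_equal_0_iff_equal zero_neq_one)
  moreover have "poly (pderiv ?P) x \<noteq> 0" for x
    by (simp only: d) simp
  ultimately have "card {x. poly ?P x = 0} = q"
    using card_roots_eq_degree[of ?P] by simp
  then show ?thesis
    by (simp add: poly_monom)
qed

section \<open>Lower bound\<close>

lemma degree_Poly_less: "xs \<noteq> [] \<Longrightarrow> Polynomial.degree (Poly xs) < length xs"
  by (induction xs) (fastforce simp: degree_pCons_eq_if)+

text \<open>\<open>Poly\<close> forgets trailing zeros of a coefficient list; fixing the length
  restores injectivity.\<close>

lemma Poly_inject:
  assumes "length xs = length ys" "Poly xs = Poly ys"
  shows "xs = ys"
  using assms by (induction xs ys rule: list_induct2) auto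

lemma poly_Poly_closed:
  assumes "0 \<in> F" "\<And>x y. x \<in> F \<Longrightarrow> y \<in> F \<Longrightarrow> x + y \<in> F"
    "\<And>x y. x \<in> F \<Longrightarrow> y \<in> F \<Longrightarrow> x * y \<in> F" "set xs \<subseteq> F" "x \<in> F"
  shows "poly (Poly xs) x \<in> F"
  using assms(4) by (induction xs) (auto intro: assms)

lemma ones_le_zarankiewicz:
  assumes "A \<in> zero_one_mat m n" "\<not> has_all_ones_submatrix s t A"
  shows "ones A \<le> zarankiewicz m n s t"
  unfolding zarankiewicz_def using assms by (intro Max_ge finite_ones_image) auto

text \<open>Point-graph incidence matrix. Taking \<open>F\<close> as a subset of an ambient domain
  lets one type serve all orders, and roots are counted in that domain.\<close>

lemma zarankiewicz_ge_finite_subring: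
  fixes F :: "'a :: idom set"
  assumes F: "finite F" "0 \<in> F" "\<And>x y. x \<in> F \<Longrightarrow> y \<in> F \<Longrightarrow> x + y \<in> F"
    "\<And>x y. x \<in> F \<Longrightarrow> y \<in> F \<Longrightarrow> x * y \<in> F"
  assumes m: "card F ^ 2 \<le> m" and n: "card F ^ t \<le> n" and "t > 0"
  shows "card F ^ (t + 1) \<le> zarankiewicz m n t 2"
proof -
  \<comment> \<open>Coefficient lists of length \<open>t\<close> represent each polynomial over
    \<open>F\<close> of degree less than \<open>t\<close> exactly once. Below, \<open>g\<close>
    numbers them as columns and \<open>h\<close> numbers the points of the plane as rows.\<close>
  define C where "C = {xs. set xs \<subseteq> F \<and> length xs = t}"
  have C: "finite C" "card C = card F ^ t"
    unfolding C_def by (rule finite_lists_length_eq[OF F(1)], rule card_lists_length_eq[OF F(1)])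
  obtain g where g: "bij_betw g C {0..<card C}"
    using ex_bij_betw_finite_nat[OF C(1)] by blast
  obtain h where h: "bij_betw h (F \<times> F) {0..<card (F \<times> F)}"
    using ex_bij_betw_finite_nat[OF finite_cartesian_product[OF F(1) F(1)]] by blast
  have g_less: "g xs < n" if "xs \<in> C" for xs
    using bspec[OF bij_betwE[OF g] that] n C(2) by simp
  have h_less: "h z < m" if "z \<in> F \<times> F" for z
    using bspec[OF bij_betwE[OF h] that] m by (simp add: power2_eq_square card_cartesian_product)
  have eval: "poly (Poly xs) x \<in> F" if "xs \<in> C" "x \<in> F" for xs x
    by (rule poly_Poly_closed) (use that F(2) in \<open>simp_all add: F(3,4) C_def\<close>)
  have g_inj: "xs = ys" if "g xs = g ys" "xs \<in> C" "ys \<in> C" for xs ys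
    using g that by (meson bij_betw_def inj_on_def)
  have h_inj: "z = w" if "h z = h w" "z \<in> F \<times> F" "w \<in> F \<times> F" for z w
    using h that by (meson bij_betw_def inj_on_def)
  define pt where "pt xs x = h (x, poly (Poly xs) x)" for xs x
  have pt_less: "pt xs x < m" if "xs \<in> C" "x \<in> F" for xs x
    unfolding pt_def using eval[OF that] that by (intro h_less) simp
  have pt_inj: "x = y \<and> poly (Poly xs) x = poly (Poly ys) x"
    if "pt xs x = pt ys y" "xs \<in> C" "ys \<in> C" "x \<in> F" "y \<in> F" for xs ys x y
    using h_inj[of "(x, poly (Poly xs) x)" "(y, poly (Poly ys) y)"]
      that eval[of xs x] eval[of ys y] by (auto simp: pt_def)
  \<comment> \<open>Rows and columns outside the ranges of \<open>h\<close> and \<open>g\<close> are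
    padded with zeros.\<close>
  define A :: "nat mat" where
    "A = mat m n (\<lambda>(i, j). if \<exists>xs\<in>C. \<exists>x\<in>F. i = pt xs x \<and> j = g xs then 1 else 0)"
  have A: "A \<in> zero_one_mat m n"
    by (auto simp: A_def zero_one_mat_def elements_mat_def split: if_splits)
  have entry: "\<exists>x\<in>F. i = pt xs x" if "A $$ (i, g xs) = 1" "i < m" "xs \<in> C" for i xs
  proof -
    have "\<exists>ys\<in>C. \<exists>x\<in>F. i = pt ys x \<and> g xs = g ys"
      using that g_less[OF that(3)] by (auto simp: A_def split: if_splits)
    then show ?thesis
      using g_inj[OF _ that(3)] by blast
  qed
  have "\<not> has_all_ones_submatrix t 2 A"
  proof
    assume "has_all_ones_submatrix t 2 A"
    then obtain I J where IJ: "I \<subseteq> {..<m}" "card I = t" "card J = 2"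
        "\<And>i j. i \<in> I \<Longrightarrow> j \<in> J \<Longrightarrow> A $$ (i, j) = 1" and J: "J \<subseteq> {..<n}"
      unfolding has_all_ones_submatrix_def A_def by auto
    from \<open>card J = 2\<close> obtain j1 j2 where j: "j1 \<in> J" "j2 \<in> J" "j1 \<noteq> j2"
      by (auto simp: card_2_iff)
    obtain i0 where i0: "i0 \<in> I"
      using IJ(2) \<open>t > 0\<close> by fastforce
    \<comment> \<open>The row \<open>i0\<close> has a 1 in column \<open>j\<close>, so
      \<open>j\<close> is not a padding column.\<close>
    have col: "\<exists>xs\<in>C. j = g xs" if "j \<in> J" for j
    proof -
      have "i0 < m" "j < n"
        using IJ(1) J i0 that by auto
      then show ?thesis
        using IJ(4)[OF i0 that] by (auto simp: A_def split: if_splits)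
    qed
    obtain xs ys where xs: "xs \<in> C" "j1 = g xs" and ys: "ys \<in> C" "j2 = g ys"
      using col j by metis
    define r where "r = Poly xs - Poly ys"
    have "r \<noteq> 0"
      using Poly_inject[of xs ys] xs ys j(3) by (auto simp: r_def C_def)
    have "Polynomial.degree (Poly zs) < t" if "zs \<in> C" for zs
      using degree_Poly_less[of zs] that \<open>t > 0\<close> by (auto simp: C_def)
    then have "Polynomial.degree r < t"
      unfolding r_def using xs(1) ys(1) by (intro degree_diff_less)
    \<comment> \<open>A row in \<open>I\<close> is a point on both graphs, so its first coordinate
      is a root of the difference \<open>r\<close>. As \<open>r\<close> has fewer than
      \<open>t\<close> roots, \<open>I\<close> is too small.\<close>
    have "I \<subseteq> pt xs ` {x. poly r x = 0}"
    proof
      fix i assume i: "i \<in> I"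
      then have "i < m" using IJ(1) by auto
      then obtain x y where "x \<in> F" "i = pt xs x" "y \<in> F" "i = pt ys y"
        using entry IJ(4)[OF i] j xs ys by metis
      with pt_inj[of xs x ys y] xs ys show "i \<in> pt xs ` {x. poly r x = 0}"
        by (auto simp: r_def)
    qed
    then have "card I \<le> card {x. poly r x = 0}"
      using poly_roots_finite[OF \<open>r \<noteq> 0\<close>] by (meson surj_card_le)
    also have "\<dots> \<le> Polynomial.degree r"
      by (rule card_poly_roots_bound[OF \<open>r \<noteq> 0\<close>])
    finally show False
      using \<open>Polynomial.degree r < t\<close> IJ(2) by simp
  qed
  moreover have "card F ^ (t + 1) \<le> ones A"
  proof -
    \<comment> \<open>Each graph has one point over each element of \<open>F\<close>, giving
      \<open>card F ^ t * card F\<close> distinct ones.\<close>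
    have "inj_on (\<lambda>(xs, x). (pt xs x, g xs)) (C \<times> F)"
      using g_inj pt_inj by (auto intro!: inj_onI)
    then have "card (C \<times> F) \<le>
        card {(i, j). i < dim_row A \<and> j < dim_col A \<and> A $$ (i, j) = 1}"
    proof (rule card_inj_on_le)
      show "(\<lambda>(xs, x). (pt xs x, g xs)) ` (C \<times> F) \<subseteq>
          {(i, j). i < dim_row A \<and> j < dim_col A \<and> A $$ (i, j) = 1}"
        using pt_less g_less by (auto simp: A_def) blast
      show "finite {(i, j). i < dim_row A \<and> j < dim_col A \<and> A $$ (i, j) = 1}"
        by (rule finite_subset[of _ "{..<dim_row A} \<times> {..<dim_col A}"]) auto
    qed
    then show ?thesis
      using C by (simp add: ones_def card_cartesian_product mult.commute)
  qed
  ultimately show ?thesis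
    using ones_le_zarankiewicz[OF A] by fastforce
qed

lemma zarankiewicz_ge_power2:
  assumes "k > 0" "(2 ^ k) ^ 2 \<le> m" "(2 ^ k) ^ t \<le> n" "t > 0"
  shows "(2 ^ k) ^ (t + 1) \<le> zarankiewicz m n t 2"
proof -
  \<comment> \<open>This is the field of order \<open>2 ^ k\<close> inside the closure; closure
    under addition is the freshman's dream.\<close>
  define F where "F = {x :: bit alg_closure. x ^ 2 ^ k = x}"
  have char: "CHAR(bit) = 2"
    by (rule CHAR_eqI) (simp, metis dvd_0_right even_of_nat_iff)
  have card: "card F = 2 ^ k"
    using card_frobenius_fixed_points[where ?'a = "bit alg_closure", of k] \<open>k > 0\<close>
    by (simp add: char F_def)
  have "finite F"
    using card by (metis card.infinite power_not_zero zero_neq_numeral)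
  moreover have "x + y \<in> F" if "x \<in> F" "y \<in> F" for x y
    using freshmans_dream'[of "2 ^ k" k x y] that by (simp add: F_def char)
  moreover have "x * y \<in> F" if "x \<in> F" "y \<in> F" for x y
    using that by (simp add: F_def power_mult_distrib)
  moreover have "0 \<in> F"
    by (simp add: F_def)
  ultimately show ?thesis
    using zarankiewicz_ge_finite_subring[of F m t n] assms by (simp add: card)
qed

section \<open>Upper bound\<close>

text \<open>If d > t a, then d >= t because a >= 1, and (d choose t) >= (d/t)^t >= (d/t)
  a^(t-1).\<close>

lemma le_plus_binomial:
  fixes a :: real
  assumes "a \<ge> 1" "t > 0"
  shows "real d \<le> real t * a + real t / a ^ (t - 1) * real (d choose t)"
proof (cases "real d \<le> real t * a")
  case True
  then show ?thesis
    using assms by (simp add: add_increasing2)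
next
  case False
  define x where "x = real d / real t"
  have "x \<ge> a"
    using False \<open>t > 0\<close> by (simp add: x_def field_simps)
  have "real t \<le> real t * a"
    using assms by simp
  with False have "t \<le> d"
    by linarith
  have "x * a ^ (t - 1) \<le> x * x ^ (t - 1)"
    using \<open>x \<ge> a\<close> assms by (intro mult_left_mono power_mono) auto
  also have "\<dots> = x ^ t"
    using \<open>t > 0\<close> by (simp flip: power_Suc)
  also have "\<dots> \<le> real (d choose t)"
    using binomial_ge_n_over_k_pow_k[OF \<open>t \<le> d\<close>, where ?'a = real] by (simp add: x_def)
  finally have "x \<le> real (d choose t) / a ^ (t - 1)"
    using assms by (simp add: field_simps)
  then have "real d \<le> real t / a ^ (t - 1) * real (d choose t)"
    using \<open>t > 0\<close> by (simp add: x_def field_simps)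
  then show ?thesis
    using assms by (simp add: add_increasing)
qed

text \<open>Double counting: a \<open>t\<close>-set of rows on which two columns are both 1 would be
  a forbidden submatrix, so the families of \<open>t\<close>-sets belonging to distinct columns are
  disjoint.\<close>

lemma sum_column_binomials_le:
  assumes "A \<in> carrier_mat m n" "\<not> has_all_ones_submatrix t 2 A"
  shows "(\<Sum>j<n. card {i. i < m \<and> A $$ (i, j) = 1} choose t) \<le> m choose t"
proof -
  define D where "D j = {i. i < m \<and> A $$ (i, j) = 1}" for j
  define S where "S j = {I. I \<subseteq> D j \<and> card I = t}" for j
  have fin: "finite (D j)" for j
    by (simp add: D_def)
  have dim: "dim_row A = m" "dim_col A = n"
    using assms(1) by auto
  have disj: "S j \<inter> S j' = {}" if "j < n" "j' < n" "j \<noteq> j'" for j j'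
  proof (rule ccontr)
    assume "S j \<inter> S j' \<noteq> {}"
    then obtain I where "I \<subseteq> D j" "I \<subseteq> D j'" "card I = t"
      by (auto simp: S_def)
    then have "has_all_ones_submatrix t 2 A"
      unfolding has_all_ones_submatrix_def using that dim
      by (intro exI[of _ I] exI[of _ "{j, j'}"]) (auto simp: D_def)
    with assms(2) show False by blast
  qed
  have "(\<Sum>j<n. card (D j) choose t) = (\<Sum>j<n. card (S j))"
    by (simp add: S_def n_subsets[OF fin])
  also have "\<dots> = card (\<Union>j<n. S j)"
    using fin disj by (subst card_UN_disjoint) (auto simp: S_def)
  also have "\<dots> \<le> card {I. I \<subseteq> {..<m} \<and> card I = t}"
    by (intro card_mono) (auto simp: S_def D_def)
  also have "\<dots> = m choose t"
    by (simp add: n_subsets)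
  finally show ?thesis
    by (simp add: D_def)
qed

lemma ones_eq_sum_columns:
  assumes "A \<in> carrier_mat m n"
  shows "ones A = (\<Sum>j<n. card {i. i < m \<and> A $$ (i, j) = 1})"
proof -
  have "ones A = card ((\<lambda>(j, i). (i, j)) ` (SIGMA j:{..<n}. {i. i < m \<and> A $$ (i, j) = 1}))"
    unfolding ones_def using assms by (intro arg_cong[where f = card]) auto
  also have "\<dots> = card (SIGMA j:{..<n}. {i. i < m \<and> A $$ (i, j) = 1})"
    by (intro card_image) (auto intro: inj_onI)
  finally show ?thesis
    by simp
qed

text \<open>An extremal matrix is bounded column by column. The threshold \<open>a\<close> stays
  free here, to be chosen later so that both terms have the same order.\<close>

lemma zarankiewicz_le:
  fixes a :: real
  assumes "a \<ge> 1" "t > 0"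
  shows "real (zarankiewicz m n t 2) \<le>
    real n * (real t * a) + real t / a ^ (t - 1) * real (m choose t)"
proof -
  have "zarankiewicz m n t 2 \<in>
      ones ` {A \<in> zero_one_mat m n. \<not> has_all_ones_submatrix t 2 A}"
    unfolding zarankiewicz_def
    using zarankiewicz_feasible_nonempty[of t 2 m n] \<open>t > 0\<close>
    by (intro Max_in finite_ones_image) auto
  then obtain A where A: "A \<in> carrier_mat m n" "\<not> has_all_ones_submatrix t 2 A"
      "zarankiewicz m n t 2 = ones A"
    by (auto simp: zero_one_mat_def)
  define d where "d j = card {i. i < m \<and> A $$ (i, j) = 1}" for j
  have "real (ones A) = (\<Sum>j<n. real (d j))"
    by (simp add: ones_eq_sum_columns[OF A(1)] d_def)
  also have "\<dots> \<le> (\<Sum>j<n. real t * a + real t / a ^ (t - 1) * real (d j choose t))"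
    using assms by (intro sum_mono le_plus_binomial) auto
  also have "\<dots> = real n * (real t * a) + real t / a ^ (t - 1) * real (\<Sum>j<n. d j choose t)"
    by (simp add: sum.distrib sum_distrib_left)
  also have "\<dots> \<le> real n * (real t * a) + real t / a ^ (t - 1) * real (m choose t)"
    using sum_column_binomials_le[OF A(1,2)] assms
    by (intro add_left_mono mult_left_mono) (simp_all add: d_def del: of_nat_sum)
  finally show ?thesis
    by (simp add: A(3))
qed

section \<open>Asymptotics\<close>

theorem theorem3:
  fixes t :: nat
  assumes "t \<ge> 2"
  shows "(\<lambda>n. real (zarankiewicz (nat \<lfloor>real n powr (2 / real t)\<rfloor>) n t 2))
           \<in> \<Theta>[sequentially](\<lambda>n. real n powr (1 + 1 / real t))"
proof (rule bigthetaI')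
  \<comment> \<open>The lower constant pays for rounding the field order down to a power of 2, a
    factor of at most 2. The upper one adds two terms, each at most
    \<open>t * a ^ (t + 1)\<close>.\<close>
  show "(1 / 2) ^ (t + 1) > (0 :: real)" "2 * real t > 0"
    using assms by auto
  show "\<forall>\<^sub>F n in sequentially.
      (1 / 2) ^ (t + 1) * norm (real n powr (1 + 1 / real t)) \<le>
        norm (real (zarankiewicz (nat \<lfloor>real n powr (2 / real t)\<rfloor>) n t 2)) \<and>
      norm (real (zarankiewicz (nat \<lfloor>real n powr (2 / real t)\<rfloor>) n t 2)) \<le>
        2 * real t * norm (real n powr (1 + 1 / real t))"
    \<comment> \<open>From n >= 2^t follows a >= 2, which makes the exponent \<open>k\<close> of the
      field order positive.\<close>
    using eventually_ge_at_top[of "2 ^ t"]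
  proof eventually_elim
    case (elim n)
    define a where "a = real n powr (1 / real t)"
    define m where "m = nat \<lfloor>real n powr (2 / real t)\<rfloor>"
    have "n > 0"
      using elim by (metis less_le_trans zero_less_numeral zero_less_power)
    have at: "a ^ t = real n"
      using \<open>n > 0\<close> assms by (simp add: a_def powr_realpow[symmetric] powr_powr)
    have a2: "real n powr (2 / real t) = a ^ 2"
      using \<open>n > 0\<close> by (simp add: a_def powr_realpow[symmetric] powr_powr)
    have target: "real n powr (1 + 1 / real t) = a ^ (t + 1)"
      using \<open>n > 0\<close> at by (simp add: powr_add a_def)
    have "a \<ge> 0"
      by (simp add: a_def)
    have "real (2 ^ t) \<le> real n"
      using elim by (simp only: of_nat_le_iff)
    then have "2 ^ t \<le> a ^ t"
      by (simp add: at)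
    then have "a \<ge> 2"
      using \<open>a \<ge> 0\<close> assms by (simp add: power_mono_iff)
    have m_le: "real m \<le> a ^ 2"
      using a2 \<open>a \<ge> 0\<close> by (simp add: m_def)
    have "nat \<lfloor>a\<rfloor> \<ge> 2"
      using \<open>a \<ge> 2\<close> by (simp add: le_nat_floor)
    then obtain k where k: "2 ^ k \<le> nat \<lfloor>a\<rfloor>" "nat \<lfloor>a\<rfloor> < 2 ^ (k + 1)"
      using ex_power_ivl1[of 2 "nat \<lfloor>a\<rfloor>"] by auto
    have "k > 0"
      using k(2) \<open>nat \<lfloor>a\<rfloor> \<ge> 2\<close> by (cases k) auto
    have "real (2 ^ k) \<le> real (nat \<lfloor>a\<rfloor>)"
      using k(1) by (simp only: of_nat_le_iff)
    also have "\<dots> \<le> a"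
      using \<open>a \<ge> 0\<close> by (rule of_nat_floor)
    finally have ka: "2 ^ k \<le> a"
      by simp
    \<comment> \<open>The strict bound on the integer floor gains 1, which absorbs the fractional
      part of \<open>a\<close>.\<close>
    have "nat \<lfloor>a\<rfloor> + 1 \<le> 2 * 2 ^ k"
      using k(2) by simp
    then have "real (nat \<lfloor>a\<rfloor> + 1) \<le> real (2 * 2 ^ k)"
      by (simp only: of_nat_le_iff)
    then have ak: "a / 2 \<le> 2 ^ k"
      using \<open>a \<ge> 0\<close> by simp linarith
    have "real ((2 ^ k) ^ 2) \<le> a ^ 2"
      using ka by (simp add: power_mono)
    then have "(2 ^ k) ^ 2 \<le> m"
      by (simp add: m_def a2 le_nat_floor)
    moreover have "real ((2 ^ k) ^ t) \<le> real n"
      using power_mono[OF ka, of t] at by simp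
    then have "(2 ^ k) ^ t \<le> n"
      by (simp only: of_nat_le_iff)
    ultimately have "(2 ^ k) ^ (t + 1) \<le> zarankiewicz m n t 2"
      using assms \<open>k > 0\<close> by (intro zarankiewicz_ge_power2) auto
    then have "real ((2 ^ k) ^ (t + 1)) \<le> real (zarankiewicz m n t 2)"
      by (simp only: of_nat_le_iff)
    moreover have "(a / 2) ^ (t + 1) \<le> (2 ^ k) ^ (t + 1)"
      using ak \<open>a \<ge> 0\<close> by (intro power_mono) auto
    ultimately have lower: "(1 / 2) ^ (t + 1) * a ^ (t + 1) \<le> real (zarankiewicz m n t 2)"
      by (simp add: power_divide)
    \<comment> \<open>Since m <= a^2, the binomial is at most a^(2t) = a^(t+1) a^(t-1), and the last
      factor cancels the denominator.\<close>
    have "real (m choose t) \<le> real m ^ t"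
      by (metis binomial_eq_0 binomial_le_pow not_le of_nat_0_le_iff of_nat_le_iff of_nat_power
          of_nat_0 zero_le_power)
    also have "\<dots> \<le> (a ^ 2) ^ t"
      using m_le by (intro power_mono) auto
    also have "\<dots> = a ^ (t + 1) * a ^ (t - 1)"
      using assms by (simp flip: power_mult power_add power_Suc add: mult_2)
    finally have "real t / a ^ (t - 1) * real (m choose t) \<le> real t * a ^ (t + 1)"
      using \<open>a \<ge> 2\<close> by (simp add: divide_le_eq mult.assoc mult_left_mono)
    moreover have "real n * (real t * a) = real t * a ^ (t + 1)"
      by (simp flip: at)
    ultimately have "real (zarankiewicz m n t 2) \<le> 2 * real t * a ^ (t + 1)"
      using zarankiewicz_le[of a t m n] \<open>a \<ge> 2\<close> assms by linarith
    with lower \<open>a \<ge> 0\<close> show ?case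
      by (simp only: target flip: m_def) simp
  qed
qed

end
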